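(* Let $(V, V^+, e)$ be an order unit space and let $X$ be a real normed linear space. Then $(V \oplus_1 X, V_X^+, e_X)$ is an order unit space, where $$V_X^+ = \{ (u, x) : \Vert x \Vert e \le u \} \quad\text{and}\quad e_X := (e, 0).$$
   Context: A real ordered vector space $(V, V^+)$ is a real vector space $V$ with a cone $V^+$ (a nonempty subset closed under addition and under multiplication by non-negative reals); write $u \le v$ if $v - u \in V^+$. An element $e \in V^+$ is an order unit for $V$ if for every $v \in V$ there is a real $\lambda > 0$ with $\lambda e \pm v \in V^+$ (i.e. both $\lambda e + v$ and $\lambda e - v$ are in $V^+$); it determines the seminorm $\Vert v \Vert_e := \inf\{ \lambda > 0 : \lambda e \pm v \in V^+ \}$. $V^+$ is proper if $V^+ \cap -V^+ = \{0\}$. $V^+$ is Archimedean if for every $v \in V$ such that $\lambda u + v \in V^+$ for a fixed $u \in V$ and all $\lambda > 0$, one has $v \in V^+$. An order unit space $(V, V^+, e)$ is a real ordered vector space with an order unit $e$ such that $V^+$ is proper and Archimedean; in this case $\Vert\cdot\Vert_e$ is a norm, and $V$ is equipped with $\Vert\cdot\Vert = \Vert\cdot\Vert_e$. $V \oplus_1 X$ denotes the linear direct sum $V \oplus X$ (whose elements are the pairs $(u, x)$ with $u \in V$, $x \in X$) with the norm $\Vert (v, x) \Vert_1 = \Vert v \Vert + \Vert x \Vert$; that $(V \oplus_1 X, V_X^+, e_X)$ is an order unit space includes that the order unit norm determined by $e_X$ equals $\Vert\cdot\Vert_1$.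
   Formalization: The formal statement additionally assumes that V is nonzero or X is zero; for V = {0}, e = 0 and X nonzero, the set V_X^+ is all of V ⊕ X, hence not proper, and the claim fails. *)

theory Defs
  imports "HOL-Analysis.Analysis"
begin

text \<open>
  An ordered vector space is a type of class \<^class>\<open>real_vector\<close> (no norm or topology is
  presupposed) together with a cone \<open>C\<close>, given as a set.  The library predicate \<^const>\<open>cone\<close>
  only expresses closure under multiplication by non-negative reals.
\<close>

definition ordering_cone :: "'v::real_vector set \<Rightarrow> bool" where
  "ordering_cone C \<longleftrightarrow> C \<noteq> {} \<and> (\<forall>u\<in>C. \<forall>v\<in>C. u + v \<in> C) \<and> cone C"

definition cone_le :: "'v::real_vector set \<Rightarrow> 'v \<Rightarrow> 'v \<Rightarrow> bool" where
  "cone_le C u v \<longleftrightarrow> v - u \<in> C"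

definition proper_cone :: "'v::real_vector set \<Rightarrow> bool" where
  "proper_cone C \<longleftrightarrow> C \<inter> uminus ` C = {0}"

definition archimedean_cone :: "'v::real_vector set \<Rightarrow> bool" where
  "archimedean_cone C \<longleftrightarrow>
     (\<forall>v. (\<exists>u. \<forall>l>0. l *\<^sub>R u + v \<in> C) \<longrightarrow> v \<in> C)"

definition order_unit :: "'v::real_vector set \<Rightarrow> 'v \<Rightarrow> bool" where
  "order_unit C e \<longleftrightarrow>
     e \<in> C \<and> (\<forall>v. \<exists>l>0. l *\<^sub>R e + v \<in> C \<and> l *\<^sub>R e - v \<in> C)"

definition order_unit_norm :: "'v::real_vector set \<Rightarrow> 'v \<Rightarrow> 'v \<Rightarrow> real" where
  "order_unit_norm C e v =
     Inf {l. l > 0 \<and> l *\<^sub>R e + v \<in> C \<and> l *\<^sub>R e - v \<in> C}"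

definition order_unit_space :: "'v::real_vector set \<Rightarrow> 'v \<Rightarrow> bool" where
  "order_unit_space C e \<longleftrightarrow>
     ordering_cone C \<and> order_unit C e \<and> proper_cone C \<and> archimedean_cone C"

text \<open>
  The direct sum of \<open>V\<close> and \<open>X\<close> is the product type with its componentwise
  \<^class>\<open>real_vector\<close> structure.  Its norm is the explicit function below, not the (Euclidean)
  library norm on products.
\<close>

definition direct_sum_norm1 ::
    "'v::real_vector set \<Rightarrow> 'v \<Rightarrow> 'v \<times> 'x::real_normed_vector \<Rightarrow> real" where
  "direct_sum_norm1 C e = (\<lambda>(v, x). order_unit_norm C e v + norm x)"

definition adjoined_cone ::
    "'v::real_vector set \<Rightarrow> 'v \<Rightarrow> ('v \<times> 'x::real_normed_vector) set" where
  "adjoined_cone C e = {(u, x). cone_le C (norm x *\<^sub>R e) u}"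

definition adjoined_unit :: "'v::real_vector \<Rightarrow> 'v \<times> 'x::real_normed_vector" where
  "adjoined_unit e = (e, 0)"

text \<open>
  The zero space, with \<open>e = 0\<close>, is an order unit space; adjoining a nonzero normed space to it
  yields a cone that is not proper.  Hence this combination has to be excluded when the
  construction is claimed to give an order unit space.
\<close>

lemma order_unit_space_zero:
  assumes "(UNIV :: 'v::real_vector set) = {0}"
  shows "order_unit_space {0 :: 'v} 0"
proof -
  have z: "v = 0" for v :: 'v
    using assms by auto
  show ?thesis
    unfolding order_unit_space_def ordering_cone_def order_unit_def proper_cone_def
      archimedean_cone_def cone_def
    using z by (auto intro: exI[of _ "1::real"])
qed

lemma not_order_unit_space_adjoined_zero:
  assumes "(UNIV :: 'v::real_vector set) = {0}" and "(UNIV :: 'x::real_normed_vector set) \<noteq> {0}"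
  shows "\<not> order_unit_space (adjoined_cone {0 :: 'v} 0 :: ('v \<times> 'x) set) (adjoined_unit 0)"
proof -
  obtain x :: 'x where x: "x \<noteq> 0"
    using assms(2) by auto
  have "(0, y) \<in> (adjoined_cone {0 :: 'v} 0 :: ('v \<times> 'x) set)" for y
    by (simp add: adjoined_cone_def cone_le_def)
  then have "(0, x) \<in> adjoined_cone {0 :: 'v} 0 \<inter> uminus ` adjoined_cone {0 :: 'v} 0"
    by (auto intro!: image_eqI[of _ _ "(0, - x)"])
  with x show ?thesis
    by (auto simp: order_unit_space_def proper_cone_def zero_prod_def)
qed

end

theory Submission
  imports Defs
begin

text \<open>
  Membership in the adjoined cone is a condition on the first component only:
  \<open>(u, x)\<close> is positive iff \<open>u - norm x *\<^sub>R e\<close> is.  Each cone axiom for \<open>V \<oplus> X\<close> therefore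
  reduces to the same axiom for \<open>V\<close>, the triangle inequality in \<open>X\<close> being absorbed by adding
  a non-negative multiple of \<open>e\<close>.

  For the norm, the two facts that matter are the following.  In an order unit space with
  \<open>e \<noteq> 0\<close> the infimum that defines \<open>\<parallel>v\<parallel>\<close> is attained, so that \<open>m e \<plusminus> v \<in> C\<close> is equivalent to
  \<open>\<parallel>v\<parallel> \<le> m\<close> for \<^emph>\<open>every\<close> real \<open>m\<close> (lemma \<open>order_unit_interval_iff\<close>); here properness
  disposes of negative \<open>m\<close> and the Archimedean property gives attainment.  Moreover
  \<open>l e\<^sub>X \<plusminus> (v, x)\<close> are positive iff \<open>(l - \<parallel>x\<parallel>) e \<plusminus> v\<close> are
  (lemma \<open>adjoined_interval_iff\<close>).  Together they say that \<open>l\<close> bounds \<open>(v, x)\<close> iff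
  \<open>\<parallel>v\<parallel> + \<parallel>x\<parallel> \<le> l\<close>, which is the claimed formula.

  If \<open>e = 0\<close>, then \<open>V\<close> is the zero space; the hypothesis then makes \<open>X\<close> zero too, and the
  shift by \<open>\<parallel>x\<parallel>\<close> disappears.
\<close>

lemma ordering_cone_zero: "ordering_cone C \<Longrightarrow> 0 \<in> C"
  unfolding ordering_cone_def using cone_contains_0 by blast

lemma ordering_cone_add: "ordering_cone C \<Longrightarrow> u \<in> C \<Longrightarrow> v \<in> C \<Longrightarrow> u + v \<in> C"
  unfolding ordering_cone_def by blast

lemma ordering_cone_scaleR: "ordering_cone C \<Longrightarrow> 0 \<le> a \<Longrightarrow> u \<in> C \<Longrightarrow> a *\<^sub>R u \<in> C"
  unfolding ordering_cone_def cone_def by blast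

lemma proper_cone_eq_zero:
  assumes "proper_cone C" "u \<in> C" "- u \<in> C"
  shows "u = 0"
proof -
  have "u \<in> C \<inter> uminus ` C"
    using assms(2,3) by (metis IntI image_eqI minus_minus)
  then show ?thesis
    using assms(1) unfolding proper_cone_def by blast
qed

lemma order_unit_space_trivial_if_unit_zero:
  fixes C :: "'v::real_vector set" and v :: 'v
  assumes "order_unit_space C e" "e = 0"
  shows "v = 0"
proof -
  have "v \<in> C" "- v \<in> C"
    using assms unfolding order_unit_space_def order_unit_def by auto
  then show ?thesis
    using assms(1) proper_cone_eq_zero unfolding order_unit_space_def by blast
qed

lemma add_unit_multiple_in_cone:
  assumes "ordering_cone C" "e \<in> C" "m *\<^sub>R e + v \<in> C" "m \<le> n"
  shows "n *\<^sub>R e + v \<in> C"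
proof -
  have "(n - m) *\<^sub>R e + (m *\<^sub>R e + v) \<in> C"
    by (rule ordering_cone_add[OF assms(1) ordering_cone_scaleR[OF assms(1)]]) (use assms in auto)
  then show ?thesis
    by (simp add: algebra_simps)
qed

lemma order_unit_norm_nonneg:
  assumes "order_unit C e"
  shows "0 \<le> order_unit_norm C e v"
  unfolding order_unit_norm_def
proof (rule cInf_greatest)
  show "{l. 0 < l \<and> l *\<^sub>R e + v \<in> C \<and> l *\<^sub>R e - v \<in> C} \<noteq> {}"
    using assms unfolding order_unit_def by blast
qed auto

lemma order_unit_norm_le:
  assumes "0 < m" "m *\<^sub>R e + v \<in> C" "m *\<^sub>R e - v \<in> C"
  shows "order_unit_norm C e v \<le> m"
  unfolding order_unit_norm_def
proof (rule cInf_lower)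
  show "bdd_below {l. 0 < l \<and> l *\<^sub>R e + v \<in> C \<and> l *\<^sub>R e - v \<in> C}"
    by (rule bdd_belowI[of _ 0]) auto
qed (use assms in auto)

text \<open>
  The sum of \<open>m e + v\<close> and \<open>m e - v\<close> is \<open>2 m e\<close>; were \<open>m\<close> negative, a positive multiple of
  \<open>- e\<close> would be positive, which properness allows only for \<open>e = 0\<close>.
\<close>
lemma order_unit_bound_nonneg:
  assumes ous: "order_unit_space C e" and "e \<noteq> 0"
    and m: "m *\<^sub>R e + v \<in> C" "m *\<^sub>R e - v \<in> C"
  shows "0 \<le> m"
proof (rule ccontr)
  assume "\<not> 0 \<le> m"
  then have neg: "m < 0" by simp
  have oc: "ordering_cone C" and eC: "e \<in> C" and pc: "proper_cone C"
    using ous unfolding order_unit_space_def order_unit_def by auto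
  have "(m *\<^sub>R e + v) + (m *\<^sub>R e - v) \<in> C"
    using ordering_cone_add[OF oc m] .
  moreover have "(m *\<^sub>R e + v) + (m *\<^sub>R e - v) = (2 * m) *\<^sub>R e"
    by (simp only: mult_2 scaleR_left_distrib) simp
  ultimately have "(2 * m) *\<^sub>R e \<in> C"
    by simp
  then have "(- inverse (2 * m)) *\<^sub>R ((2 * m) *\<^sub>R e) \<in> C"
    using neg by (intro ordering_cone_scaleR[OF oc _ \<open>(2 * m) *\<^sub>R e \<in> C\<close>]) simp
  then have "- e \<in> C"
    using neg by simp
  then show False
    using proper_cone_eq_zero[OF pc eC] \<open>e \<noteq> 0\<close> by blast
qed

text \<open>
  The bounds of \<open>v\<close> form an upward closed set, so every number strictly above the infimum is a
  bound; the Archimedean property then passes to the infimum itself.  The equivalence covers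
  negative \<open>m\<close> because it is applied to \<open>m = l - \<parallel>x\<parallel>\<close>, whose sign is not known beforehand.
\<close>
lemma order_unit_interval_iff:
  assumes ous: "order_unit_space C e" and "e \<noteq> 0"
  shows "m *\<^sub>R e + v \<in> C \<and> m *\<^sub>R e - v \<in> C \<longleftrightarrow> order_unit_norm C e v \<le> m"
proof
  have oc: "ordering_cone C" and eC: "e \<in> C"
    using ous unfolding order_unit_space_def order_unit_def by auto
  assume bound: "m *\<^sub>R e + v \<in> C \<and> m *\<^sub>R e - v \<in> C"
  then have "0 \<le> m"
    using order_unit_bound_nonneg[OF assms] by blast
  show "order_unit_norm C e v \<le> m"
  proof (rule field_le_epsilon)
    \<comment> \<open>The infimum ranges over strictly positive bounds, and \<open>m\<close> may be \<open>0\<close>.\<close>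
    fix d :: real assume "0 < d"
    then show "order_unit_norm C e v \<le> m + d"
      using add_unit_multiple_in_cone[OF oc eC, of m v "m + d"]
        add_unit_multiple_in_cone[OF oc eC, of m "- v" "m + d"] bound \<open>0 \<le> m\<close>
      by (intro order_unit_norm_le) auto
  qed
next
  have oc: "ordering_cone C" and ou: "order_unit C e" and eC: "e \<in> C" and ac: "archimedean_cone C"
    using ous unfolding order_unit_space_def order_unit_def by auto
  assume le: "order_unit_norm C e v \<le> m"
  have above: "(m + d) *\<^sub>R e + v \<in> C \<and> (m + d) *\<^sub>R e - v \<in> C" if "0 < d" for d
  proof -
    let ?S = "{l. 0 < l \<and> l *\<^sub>R e + v \<in> C \<and> l *\<^sub>R e - v \<in> C}"
    have "?S \<noteq> {}"
      using ou unfolding order_unit_def by blast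
    moreover have "Inf ?S < m + d"
      using le that unfolding order_unit_norm_def by simp
    ultimately have "\<exists>l\<in>?S. l < m + d"
      by (rule cInf_lessD)
    then obtain l where l: "l \<in> ?S" "l < m + d" ..
    then show ?thesis
      using add_unit_multiple_in_cone[OF oc eC, of l v "m + d"]
        add_unit_multiple_in_cone[OF oc eC, of l "- v" "m + d"] by simp
  qed
  have "\<forall>d>0. d *\<^sub>R e + (m *\<^sub>R e + v) \<in> C" "\<forall>d>0. d *\<^sub>R e + (m *\<^sub>R e - v) \<in> C"
    using above by (simp_all add: algebra_simps)
  then show "m *\<^sub>R e + v \<in> C \<and> m *\<^sub>R e - v \<in> C"
    using ac unfolding archimedean_cone_def by blast
qed

lemma Inf_positive_above:
  fixes r :: real
  assumes "0 \<le> r"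
  shows "Inf {l. 0 < l \<and> r \<le> l} = r"
proof (cases "r = 0")
  case True
  then have "{l. 0 < l \<and> r \<le> l} = {0<..}"
    by auto
  then show ?thesis
    using True by simp
next
  case False
  then have "{l. 0 < l \<and> r \<le> l} = {r..}"
    using assms by auto
  then show ?thesis
    by simp
qed

lemma mem_adjoined_cone: "(u, x) \<in> adjoined_cone C e \<longleftrightarrow> u - norm x *\<^sub>R e \<in> C"
  by (simp add: adjoined_cone_def cone_le_def)

lemma adjoined_interval_iff:
  "l *\<^sub>R adjoined_unit e + (v, x) \<in> adjoined_cone C e \<and>
   l *\<^sub>R adjoined_unit e - (v, x) \<in> adjoined_cone C e \<longleftrightarrow>
   (l - norm x) *\<^sub>R e + v \<in> C \<and> (l - norm x) *\<^sub>R e - v \<in> C"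
  by (simp add: adjoined_unit_def mem_adjoined_cone algebra_simps)

text \<open>
  Passing from \<open>s\<close> to \<open>norm x\<close> adds \<open>(s - norm x) *\<^sub>R e\<close>, which is positive.  With
  \<open>s = norm x + norm y\<close> this is how the triangle inequality gives closure under addition.
\<close>
lemma adjoined_cone_if_norm_le:
  assumes "ordering_cone C" "e \<in> C" "u - s *\<^sub>R e \<in> C" "norm x \<le> s"
  shows "(u, x) \<in> adjoined_cone C e"
  using add_unit_multiple_in_cone[of C e "- s" u "- norm x"] assms
  by (simp add: mem_adjoined_cone)

lemma ordering_cone_adjoined:
  assumes oc: "ordering_cone C" and eC: "e \<in> C"
  shows "ordering_cone (adjoined_cone C e)"
  unfolding ordering_cone_def cone_def
proof (intro conjI ballI allI impI)
  have "(0, 0) \<in> adjoined_cone C e"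
    using ordering_cone_zero[OF oc] by (simp add: mem_adjoined_cone)
  then show "adjoined_cone C e \<noteq> {}"
    by blast
next
  fix p q :: "'a \<times> 'b"
  assume pq: "p \<in> adjoined_cone C e" "q \<in> adjoined_cone C e"
  obtain u x v y where p: "p = (u, x)" and q: "q = (v, y)"
    by fastforce
  have "(u - norm x *\<^sub>R e) + (v - norm y *\<^sub>R e) \<in> C"
    using pq by (intro ordering_cone_add[OF oc]) (simp_all add: p q mem_adjoined_cone)
  then have "(u + v) - (norm x + norm y) *\<^sub>R e \<in> C"
    by (simp add: algebra_simps)
  then show "p + q \<in> adjoined_cone C e"
    using adjoined_cone_if_norm_le[OF oc eC _ norm_triangle_ineq] by (simp add: p q)
next
  fix p :: "'a \<times> 'b" and a :: real
  assume "p \<in> adjoined_cone C e" "0 \<le> a"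
  moreover obtain u x where p: "p = (u, x)"
    by fastforce
  ultimately have "a *\<^sub>R (u - norm x *\<^sub>R e) \<in> C"
    by (intro ordering_cone_scaleR[OF oc]) (simp_all add: mem_adjoined_cone)
  then show "a *\<^sub>R p \<in> adjoined_cone C e"
    using \<open>0 \<le> a\<close> by (simp add: p mem_adjoined_cone scaleR_diff_right)
qed

lemma order_unit_adjoined:
  assumes ou: "order_unit C e"
  shows "order_unit (adjoined_cone C e) (adjoined_unit e)"
  unfolding order_unit_def
proof (intro conjI allI)
  show "adjoined_unit e \<in> adjoined_cone C e"
    using ou by (simp add: adjoined_unit_def mem_adjoined_cone order_unit_def)
next
  fix w :: "'a \<times> 'b"
  obtain v x where w: "w = (v, x)"
    by fastforce
  obtain l where "l > 0" "l *\<^sub>R e + v \<in> C" "l *\<^sub>R e - v \<in> C"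
    using ou unfolding order_unit_def by blast
  then show "\<exists>l>0. l *\<^sub>R adjoined_unit e + w \<in> adjoined_cone C e \<and>
                   l *\<^sub>R adjoined_unit e - w \<in> adjoined_cone C e"
    unfolding w adjoined_interval_iff
    by (intro exI[of _ "l + norm x"]) (simp add: add_pos_nonneg)
qed

text \<open>
  If \<open>\<plusminus>(u, x)\<close> are positive, then \<open>(- \<parallel>x\<parallel>) e \<plusminus> u\<close> are, so \<open>- \<parallel>x\<parallel>\<close> is a bound of \<open>u\<close>.
  For \<open>e \<noteq> 0\<close> bounds are non-negative, which forces \<open>x = 0\<close>; then \<open>\<plusminus>u \<in> C\<close>, and \<open>u = 0\<close> because
  \<open>C\<close> is proper.
\<close>
lemma proper_cone_adjoined:
  fixes C :: "'v::real_vector set"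
  assumes ous: "order_unit_space C e" and nondeg: "e \<noteq> 0 \<or> (\<forall>x::'x::real_normed_vector. x = 0)"
  shows "proper_cone (adjoined_cone C e :: ('v \<times> 'x) set)"
proof -
  let ?K = "adjoined_cone C e :: ('v \<times> 'x) set"
  have oc: "ordering_cone C" and eC: "e \<in> C" and pc: "proper_cone C"
    using ous unfolding order_unit_space_def order_unit_def by auto
  have "p = 0" if p: "p \<in> ?K" "- p \<in> ?K" for p
  proof -
    obtain u x where px: "p = (u, x)"
      by fastforce
    have bound: "(- norm x) *\<^sub>R e + u \<in> C" "(- norm x) *\<^sub>R e - u \<in> C"
      using p by (simp_all add: px mem_adjoined_cone diff_diff_eq[symmetric] minus_diff_commute)
    have "x = 0"
      using nondeg order_unit_bound_nonneg[OF ous _ bound] by auto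
    moreover have "u = 0"
      using bound \<open>x = 0\<close> by (intro proper_cone_eq_zero[OF pc]) auto
    ultimately show "p = 0"
      by (simp add: px zero_prod_def)
  qed
  moreover have "0 \<in> ?K"
    by (rule ordering_cone_zero[OF ordering_cone_adjoined[OF oc eC]])
  ultimately show ?thesis
    unfolding proper_cone_def by (auto intro: image_eqI[of _ _ 0])
qed

text \<open>
  If \<open>l (u, y) + (v, x)\<close> is positive for all \<open>l > 0\<close>, then, because
  \<open>\<parallel>x\<parallel> \<le> \<parallel>l y + x\<parallel> + l \<parallel>y\<parallel>\<close>, so is \<open>l (u + \<parallel>y\<parallel> e) + (v - \<parallel>x\<parallel> e)\<close> in \<open>V\<close>; thus the perturbation
  direction \<open>u + \<parallel>y\<parallel> e\<close> serves in \<open>V\<close>.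
\<close>
lemma archimedean_cone_adjoined:
  assumes oc: "ordering_cone C" and eC: "e \<in> C" and ac: "archimedean_cone C"
  shows "archimedean_cone (adjoined_cone C e)"
  unfolding archimedean_cone_def
proof (intro allI impI)
  fix w :: "'a \<times> 'b"
  assume "\<exists>p. \<forall>l>0. l *\<^sub>R p + w \<in> adjoined_cone C e"
  then obtain p where p: "\<And>l. l > 0 \<Longrightarrow> l *\<^sub>R p + w \<in> adjoined_cone C e"
    by blast
  obtain u y v x where py: "p = (u, y)" and wx: "w = (v, x)"
    by fastforce
  have "l *\<^sub>R (u + norm y *\<^sub>R e) + (v - norm x *\<^sub>R e) \<in> C" if "l > 0" for l
  proof -
    have "(- norm (l *\<^sub>R y + x)) *\<^sub>R e + (l *\<^sub>R u + v) \<in> C"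
      using p[OF that] by (simp add: py wx mem_adjoined_cone)
    moreover have "- norm (l *\<^sub>R y + x) \<le> l * norm y - norm x"
      using norm_triangle_ineq4[of "l *\<^sub>R y + x" "l *\<^sub>R y"] that by simp
    ultimately have "(l * norm y - norm x) *\<^sub>R e + (l *\<^sub>R u + v) \<in> C"
      by (rule add_unit_multiple_in_cone[OF oc eC])
    then show ?thesis
      by (simp add: algebra_simps)
  qed
  then have "v - norm x *\<^sub>R e \<in> C"
    using ac unfolding archimedean_cone_def by blast
  then show "w \<in> adjoined_cone C e"
    by (simp add: wx mem_adjoined_cone)
qed

lemma order_unit_norm_adjoined:
  fixes C :: "'v::real_vector set" and x :: "'x::real_normed_vector"
  assumes ous: "order_unit_space C e" and nondeg: "e \<noteq> 0 \<or> x = 0"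
  shows "order_unit_norm (adjoined_cone C e) (adjoined_unit e) (v, x) =
         order_unit_norm C e v + norm x"
proof (cases "x = 0")
  case True
  then show ?thesis
    unfolding order_unit_norm_def adjoined_interval_iff by simp
next
  case False
  with nondeg have "e \<noteq> 0"
    by blast
  have "order_unit_norm (adjoined_cone C e) (adjoined_unit e) (v, x) =
        Inf {l. 0 < l \<and> (l - norm x) *\<^sub>R e + v \<in> C \<and> (l - norm x) *\<^sub>R e - v \<in> C}"
    unfolding order_unit_norm_def adjoined_interval_iff ..
  also have "\<dots> = Inf {l. 0 < l \<and> order_unit_norm C e v + norm x \<le> l}"
    by (simp add: order_unit_interval_iff[OF ous \<open>e \<noteq> 0\<close>] le_diff_eq)
  also have "\<dots> = order_unit_norm C e v + norm x"
    using ous order_unit_norm_nonneg[of C e v]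
    by (intro Inf_positive_above) (simp add: order_unit_space_def)
  finally show ?thesis .
qed

theorem theorem2p4:
  fixes C :: "'v::real_vector set" and e :: 'v
  assumes "order_unit_space C e"
    and "(UNIV :: 'v set) \<noteq> {0} \<or> (UNIV :: 'x::real_normed_vector set) = {0}"
  shows "order_unit_space (adjoined_cone C e :: ('v \<times> 'x) set) (adjoined_unit e)
    \<and> (\<forall>w :: 'v \<times> 'x.
          order_unit_norm (adjoined_cone C e) (adjoined_unit e) w = direct_sum_norm1 C e w)"
proof -
  have parts: "ordering_cone C" "order_unit C e" "e \<in> C" "archimedean_cone C"
    using assms(1) unfolding order_unit_space_def order_unit_def by auto
  have "(UNIV :: 'v set) = {0}" if "e = 0"
    using order_unit_space_trivial_if_unit_zero[OF assms(1) that] by auto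
  then have nondeg: "e \<noteq> 0 \<or> (\<forall>x::'x. x = 0)"
    using assms(2) by auto
  have "order_unit_space (adjoined_cone C e :: ('v \<times> 'x) set) (adjoined_unit e)"
    unfolding order_unit_space_def
    using parts ordering_cone_adjoined order_unit_adjoined archimedean_cone_adjoined
      proper_cone_adjoined[OF assms(1) nondeg] by blast
  moreover have "order_unit_norm (adjoined_cone C e) (adjoined_unit e) w = direct_sum_norm1 C e w"
    for w :: "'v \<times> 'x"
    using order_unit_norm_adjoined[OF assms(1)] nondeg
    by (cases w) (auto simp: direct_sum_norm1_def)
  ultimately show ?thesis
    by blast
qed

end
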